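(* $\boldsymbol{\mathcal{V}}(\mathsf{sylv})$ and $\boldsymbol{\mathcal{V}}(\mathsf{sylv}^{\#})$ both strictly contain the varietal join $\boldsymbol{\mathcal{V}}(\mathsf{styl}_2)\vee\boldsymbol{\mathcal{C}}$.
   Context: $\mathsf{styl}_2$, the stylic monoid of rank $2$, is the monoid presented by generators $\{1<2\}$ and relations $acb=cab$ (for $a\le b<c$), $bac=bca$ (for $a<b\le c$), and $a^2=a$, where $a,b,c\in\{1,2\}$. Let $\mathbb{N}=\{1<2<3<\cdots\}$. The sylvester monoid $\mathsf{sylv}$ (of infinite rank) is presented by generators $\mathbb{N}$ and relations $cavb=acvb$ for $a\le b<c$ in $\mathbb{N}$ and $v\in\mathbb{N}^*$. The $\#$-sylvester monoid $\mathsf{sylv}^{\#}$ (of infinite rank) is presented by generators $\mathbb{N}$ and relations $bvac=bvca$ for $a<b\le c$ in $\mathbb{N}$ and $v\in\mathbb{N}^*$. Here $\mathbb{N}^*$ is the set of words over $\mathbb{N}$. A variety is a class of monoids closed under homomorphic images, submonoids and direct products; $\boldsymbol{\mathcal{V}}(M)$ is the variety generated by $M$; $\boldsymbol{\mathcal{C}}$ is the variety of all commutative monoids; the varietal join $\boldsymbol{\mathcal{U}}\vee\boldsymbol{\mathcal{W}}$ is the smallest variety containing both $\boldsymbol{\mathcal{U}}$ and $\boldsymbol{\mathcal{W}}$. *)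

theory Defs
  imports "HOL-Algebra.Product_Groups" "HOL-Library.Infinite_Typeclass"
begin

section \<open>Monoid presentations\<close>

text \<open>The least congruence on the free monoid \<^term>\<open>lists A\<close> containing \<open>R\<close>;
  \<open>R\<close> is meant to relate words over \<open>A\<close>.\<close>

inductive_set presentation_cong ::
  "'a set \<Rightarrow> ('a list \<times> 'a list) set \<Rightarrow> ('a list \<times> 'a list) set"
  for A :: "'a set" and R :: "('a list \<times> 'a list) set"
where
  rel: "\<lbrakk>(u, v) \<in> R; p \<in> lists A; q \<in> lists A\<rbrakk>
    \<Longrightarrow> (p @ u @ q, p @ v @ q) \<in> presentation_cong A R"
| refl: "w \<in> lists A \<Longrightarrow> (w, w) \<in> presentation_cong A R"
| sym: "(u, v) \<in> presentation_cong A R \<Longrightarrow> (v, u) \<in> presentation_cong A R"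
| trans: "\<lbrakk>(u, v) \<in> presentation_cong A R; (v, w) \<in> presentation_cong A R\<rbrakk>
    \<Longrightarrow> (u, w) \<in> presentation_cong A R"

definition presented_monoid ::
  "'a set \<Rightarrow> ('a list \<times> 'a list) set \<Rightarrow> 'a list set monoid" where
  "presented_monoid A R =
    \<lparr>carrier = lists A // presentation_cong A R,
     mult = (\<lambda>X Y. presentation_cong A R `` {x @ y | x y. x \<in> X \<and> y \<in> Y}),
     one = presentation_cong A R `` {[]}\<rparr>"

definition styl2 :: "nat list set monoid" where
  "styl2 = presented_monoid {1, 2}
    ({([a, c, b], [c, a, b]) | a b c. {a, b, c} \<subseteq> {1, 2} \<and> a \<le> b \<and> b < c}
   \<union> {([b, a, c], [b, c, a]) | a b c. {a, b, c} \<subseteq> {1, 2} \<and> a < b \<and> b \<le> c}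
   \<union> {([a, a], [a]) | a. a \<in> {1, 2}})"

definition sylv :: "nat list set monoid" where
  "sylv = presented_monoid {1..}
    {([c, a] @ v @ [b], [a, c] @ v @ [b]) | a b c v.
       {a, b, c} \<subseteq> {1..} \<and> v \<in> lists {1..} \<and> a \<le> b \<and> b < c}"

definition sylv_sharp :: "nat list set monoid" where
  "sylv_sharp = presented_monoid {1..}
    {([b] @ v @ [a, c], [b] @ v @ [c, a]) | a b c v.
       {a, b, c} \<subseteq> {1..} \<and> v \<in> lists {1..} \<and> a < b \<and> b \<le> c}"

section \<open>Varieties of monoids\<close>

text \<open>Classes of monoids are represented by their members with elements in a type \<open>'u\<close>,
  an arbitrary infinite type that serves as the universe.
  A direct product of members need not fit into \<open>'u\<close>, so closure under direct products
  is stated for every monoid on \<open>'u\<close> that is isomorphic to a submonoid of a direct product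
  of members. By closure under submonoids this demands nothing more of a genuine variety,
  and it subsumes the direct products that do fit. Index sets
  inside \<open>'u\<close> are no restriction: a monoid on \<open>'u\<close> embedded in some product already embeds in
  the product of \<open>'u \<times> 'u\<close> many factors (one for each pair of elements to be separated),
  and \<open>'u \<times> 'u\<close> has the cardinality of \<open>'u\<close>.
  Hence the sets below are exactly the restrictions to \<open>'u\<close> of varieties of
  monoids. The product over the empty index set puts the trivial monoids into every variety.
  Homomorphisms in \<open>epi\<close> and \<open>iso\<close> preserve the unit, because they are onto a monoid.\<close>

definition is_variety :: "('u::infinite) monoid set \<Rightarrow> bool" where
  "is_variety K \<longleftrightarrow>
     (\<forall>M\<in>K. Group.monoid M)
   \<and> (\<forall>M\<in>K. \<forall>N::'u monoid. Group.monoid N \<and> epi M N \<noteq> {} \<longrightarrow> N \<in> K)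
   \<and> (\<forall>M\<in>K. \<forall>S. submonoid S M \<longrightarrow> M\<lparr>carrier := S\<rparr> \<in> K)
   \<and> (\<forall>(I::'u set) (G::'u \<Rightarrow> 'u monoid) S (N::'u monoid).
        (\<forall>i\<in>I. G i \<in> K) \<and> submonoid S (product_group I G)
        \<and> Group.monoid N \<and> (product_group I G)\<lparr>carrier := S\<rparr> \<cong> N \<longrightarrow> N \<in> K)"

text \<open>The generator \<open>M\<close> may live on another type; it enters through its isomorphic copies on
  \<open>'u\<close>, which exist in particular whenever \<open>M\<close> is countable.\<close>

definition variety_generated_by :: "'a monoid \<Rightarrow> ('u::infinite) monoid set" where
  "variety_generated_by M =
     \<Inter>{K. is_variety K \<and> (\<forall>N::'u monoid. Group.monoid N \<and> M \<cong> N \<longrightarrow> N \<in> K)}"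

definition comm_monoids :: "('u::infinite) monoid set" where
  "comm_monoids = {M. comm_monoid M}"

definition variety_join ::
  "('u::infinite) monoid set \<Rightarrow> 'u monoid set \<Rightarrow> 'u monoid set" where
  "variety_join U W = \<Inter>{K. is_variety K \<and> U \<subseteq> K \<and> W \<subseteq> K}"

end

theory Submission
  imports Defs "HOL-Algebra.Divisibility" "HOL-Algebra.Weak_Morphisms"
begin

text \<open>Erasing the letters above 2 maps both \<open>sylv\<close> and \<open>sylv_sharp\<close> onto \<open>styl2\<close>, and the length
  of words maps them onto the additive monoid of natural numbers, which generates all commutative
  monoids. This gives the inclusions. They are strict because \<open>xyxy = yxyx\<close> holds in \<open>styl2\<close> and
  in every commutative monoid, but fails in \<open>sylv\<close>, whose congruence preserves the last letter of a
  word, and in \<open>sylv_sharp\<close>, whose congruence preserves the first letter.\<close>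

section \<open>Presented monoids\<close>

lemma presentation_cong_in_lists:
  assumes "(u, v) \<in> presentation_cong A R" "R \<subseteq> lists A \<times> lists A"
  shows "u \<in> lists A" "v \<in> lists A"
  using assms by (induction rule: presentation_cong.induct) auto

text \<open>The rule \<open>rel\<close> already allows arbitrary contexts, so the outer context is
  absorbed into the inner one and only the longer prefix and suffix must be supplied.\<close>

lemma presentation_cong_context:
  assumes "(u, v) \<in> presentation_cong A R" "p \<in> lists A" "q \<in> lists A"
  shows "(p @ u @ q, p @ v @ q) \<in> presentation_cong A R"
  using assms(1)
proof (induction rule: presentation_cong.induct)
  case (rel u v p' q')
  then show ?case
    using presentation_cong.rel[of u v R "p @ p'" A "q' @ q"] assms by auto
next
  case (refl w)
  then show ?case using assms by (simp add: presentation_cong.refl)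
qed (auto intro: presentation_cong.sym presentation_cong.trans)

lemma presentation_cong_append:
  assumes "(u, u') \<in> presentation_cong A R" "(v, v') \<in> presentation_cong A R"
    and "R \<subseteq> lists A \<times> lists A"
  shows "(u @ v, u' @ v') \<in> presentation_cong A R"
proof -
  note in_lists = presentation_cong_in_lists[OF _ assms(3)]
  have "(u @ v, u' @ v) \<in> presentation_cong A R"
    using presentation_cong_context[OF assms(1), of "[]" v] in_lists[OF assms(2)] by simp
  moreover have "(u' @ v, u' @ v') \<in> presentation_cong A R"
    using presentation_cong_context[OF assms(2), of u' "[]"] in_lists[OF assms(1)] by simp
  ultimately show ?thesis by (rule presentation_cong.trans)
qed

lemma equiv_presentation_cong:
  assumes "R \<subseteq> lists A \<times> lists A"
  shows "equiv (lists A) (presentation_cong A R)"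
proof (rule equivI)
  show "presentation_cong A R \<subseteq> lists A \<times> lists A"
    using presentation_cong_in_lists[OF _ assms] by (meson SigmaI subrelI)
  show "refl_on (lists A) (presentation_cong A R)"
    by (auto simp: refl_on_def intro: presentation_cong.refl)
  show "sym (presentation_cong A R)"
    by (auto simp: sym_def intro: presentation_cong.sym)
  show "trans (presentation_cong A R)"
    by (auto simp: trans_def intro: presentation_cong.trans)
qed

lemma carrier_presented_monoid:
  "carrier (presented_monoid A R) = (\<lambda>w. presentation_cong A R `` {w}) ` lists A"
  by (auto simp: presented_monoid_def quotient_def)

lemma one_presented_monoid:
  "\<one>\<^bsub>presented_monoid A R\<^esub> = presentation_cong A R `` {[]}"
  by (simp add: presented_monoid_def)

lemma presentation_class_eq_iff:
  assumes "R \<subseteq> lists A \<times> lists A" "u \<in> lists A" "v \<in> lists A"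
  shows "presentation_cong A R `` {u} = presentation_cong A R `` {v}
    \<longleftrightarrow> (u, v) \<in> presentation_cong A R"
  using eq_equiv_class_iff[OF equiv_presentation_cong[OF assms(1)] assms(2,3)] .

text \<open>The set of products of representatives contains \<open>u @ v\<close> and lies within its
  class, so closing it under the congruence gives exactly that class.\<close>

lemma mult_presented_monoid:
  assumes R: "R \<subseteq> lists A \<times> lists A" and uv: "u \<in> lists A" "v \<in> lists A"
  shows "presentation_cong A R `` {u} \<otimes>\<^bsub>presented_monoid A R\<^esub> presentation_cong A R `` {v}
    = presentation_cong A R `` {u @ v}"
proof -
  let ?S = "{x @ y | x y. (u, x) \<in> presentation_cong A R \<and> (v, y) \<in> presentation_cong A R}"
  have "(u @ v, s) \<in> presentation_cong A R" if "s \<in> ?S" for s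
    using that presentation_cong_append[OF _ _ R] by blast
  moreover have "u @ v \<in> ?S"
    using presentation_cong.refl[OF uv(1)] presentation_cong.refl[OF uv(2)] by blast
  ultimately have "presentation_cong A R `` ?S = presentation_cong A R `` {u @ v}"
    using presentation_cong.trans by blast
  then show ?thesis by (simp add: presented_monoid_def)
qed

lemma monoid_presented_monoid:
  assumes "R \<subseteq> lists A \<times> lists A"
  shows "Group.monoid (presented_monoid A R)"
  by (rule monoidI)
    (auto simp: carrier_presented_monoid one_presented_monoid mult_presented_monoid[OF assms]
      intro!: imageI del: in_listsD)

text \<open>The universal property of a presentation, for surjections: a multiplicative map on words
  that respects the defining relations is constant on congruence classes.\<close>

lemma presented_monoid_epi:
  fixes N (structure)
  assumes R: "R \<subseteq> lists A \<times> lists A"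
    and F: "F ` lists A = carrier N"
    and F_append: "\<And>u v. u \<in> lists A \<Longrightarrow> v \<in> lists A \<Longrightarrow> F (u @ v) = F u \<otimes> F v"
    and F_rel: "\<And>u v. (u, v) \<in> R \<Longrightarrow> F u = F v"
  shows "epi (presented_monoid A R) N \<noteq> {}"
proof -
  have inv: "F u = F v" if "(u, v) \<in> presentation_cong A R" for u v
    using that
  proof (induction rule: presentation_cong.induct)
    case (rel u v p q)
    then have "u \<in> lists A" "v \<in> lists A" using R by auto
    \<comment> \<open>Splitting off the context isolates \<open>F w\<close>, the only factor in
      which the two sides differ.\<close>
    then have "F (p @ w @ q) = F p \<otimes> (F w \<otimes> F q)" if "w \<in> {u, v}" for w
      using that rel(2,3) F_append by (metis append_in_lists_conv insertE singletonD)
    then show ?case using F_rel[OF rel(1)] by simp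
  qed auto
  \<comment> \<open>\<open>h\<close> evaluates \<open>F\<close> at a chosen representative; by
    \<open>inv\<close> the choice does not matter.\<close>
  define h where "h X = F (SOME w. w \<in> X)" for X
  have h: "h (presentation_cong A R `` {w}) = F w" if "w \<in> lists A" for w
  proof -
    have "w \<in> presentation_cong A R `` {w}"
      using presentation_cong.refl[OF that] by simp
    then have "(SOME x. x \<in> presentation_cong A R `` {w}) \<in> presentation_cong A R `` {w}"
      by (rule someI)
    then show ?thesis unfolding h_def using inv by (metis Image_singleton_iff)
  qed
  have "h ` carrier (presented_monoid A R) = carrier N"
    unfolding carrier_presented_monoid image_image F[symmetric] using h by (rule image_cong[OF HOL.refl])
  moreover from this have "h \<in> hom (presented_monoid A R) N"
    by (intro homI)
      (auto simp: carrier_presented_monoid mult_presented_monoid[OF R] h F_append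
        del: in_listsD)
  ultimately show ?thesis by (auto simp: epi_def)
qed

section \<open>Varieties\<close>

lemma image_group_iso:
  assumes "inj_on f (carrier M)" "Group.monoid M"
  shows "f \<in> iso M (image_group f M)"
  using assms by (auto simp: iso_def hom_def image_group_def bij_betw_def)

lemma monoid_image_group:
  assumes "inj_on f (carrier M)" "Group.monoid M"
  shows "Group.monoid (image_group f M)"
proof -
  interpret Group.monoid M by fact
  show ?thesis
    using assms(1) by (intro monoidI) (auto simp: image_group_def m_assoc)
qed

text \<open>Undoing the transport maps the copy onto the original, so every quotient of
  \<open>M\<close> is also a quotient of its copy.\<close>

lemma inv_into_image_group_epi:
  assumes "inj_on f (carrier M)" "Group.monoid M"
  shows "inv_into (carrier M) f \<in> epi (image_group f M) M"
proof -
  interpret Group.monoid M by fact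
  show ?thesis
    using assms(1) by (auto simp: epi_def hom_def image_group_def image_image)
qed

lemma monoid_product_group:
  assumes "\<And>i. i \<in> I \<Longrightarrow> Group.monoid (G i)"
  shows "Group.monoid (product_group I G)"
  by (rule monoidI)
    (auto simp: assms PiE_iff monoid.m_closed monoid.one_closed monoid.m_assoc
      monoid.l_one monoid.r_one extensional_def fun_eq_iff)

section \<open>Closure properties of varieties\<close>

lemma variety_epi:
  assumes "is_variety K" "M \<in> K" "epi M N \<noteq> {}" "Group.monoid N"
  shows "N \<in> K"
  using assms unfolding is_variety_def by blast

lemma variety_submonoid_product:
  fixes K :: "('u::infinite) monoid set" and I :: "'u set"
  assumes "is_variety K" "\<And>i. i \<in> I \<Longrightarrow> G i \<in> K" "submonoid S (product_group I G)"
    "Group.monoid N" "product_group I G\<lparr>carrier := S\<rparr> \<cong> N"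
  shows "N \<in> K"
  using assms(1)[unfolded is_variety_def, THEN conjunct2, THEN conjunct2, THEN conjunct2,
      rule_format, of I G S N] assms(2-5)
  by simp

text \<open>Closure under quotients of submonoids of products. The submonoid consists of functions,
  so it need not be a monoid on \<open>'u\<close>; the injection \<open>e\<close> supplies a copy
  that is, and the quotient is taken from that copy.\<close>

lemma variety_epi_submonoid_product:
  fixes K :: "('u::infinite) monoid set" and I :: "'u set" and e :: "('u \<Rightarrow> 'u) \<Rightarrow> 'u"
  assumes K: "is_variety K" and G: "\<And>i. i \<in> I \<Longrightarrow> G i \<in> K"
    and S: "submonoid S (product_group I G)" and e: "inj_on e S"
    and h: "epi (product_group I G\<lparr>carrier := S\<rparr>) N \<noteq> {}" and N: "Group.monoid N"
  shows "N \<in> K"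
proof -
  let ?P = "product_group I G\<lparr>carrier := S\<rparr>"
  have "Group.monoid (G i)" if "i \<in> I" for i
    using K G[OF that] unfolding is_variety_def by blast
  then have P: "Group.monoid ?P"
    by (intro submonoid.submonoid_is_monoid[OF S] monoid_product_group)
  have e': "inj_on e (carrier ?P)" using e by simp
  have "?P \<cong> image_group e ?P"
    using image_group_iso[OF e' P] by (auto simp: is_iso_def)
  then have "image_group e ?P \<in> K"
    by (rule variety_submonoid_product[OF K G S monoid_image_group[OF e' P], rotated])
  moreover have "epi (image_group e ?P) N \<noteq> {}"
    using epi_compose[OF inv_into_image_group_epi[OF e' P]] h by blast
  ultimately show ?thesis by (rule variety_epi[OF K _ _ N])
qed

text \<open>An infinite type is in bijection with its square; iterating such a pairing codes words
  by single elements.\<close>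

lemma ex_inj_lists: "\<exists>e :: ('u::infinite) list \<Rightarrow> 'u. inj e"
proof -
  have "(card_of (UNIV \<times> UNIV :: ('u \<times> 'u) set), card_of (UNIV :: 'u set)) \<in> ordIso"
    by (rule card_of_Times_same_infinite) (rule infinite_UNIV)
  then obtain p :: "'u \<times> 'u \<Rightarrow> 'u" where "bij_betw p (UNIV \<times> UNIV) UNIV"
    unfolding card_of_ordIso[symmetric] by blast
  then have p: "inj p" by (simp add: bij_betw_def)
  obtain n :: "nat \<Rightarrow> 'u" where n: "inj n"
    using infinite_countable_subset[OF infinite_UNIV] by blast
  define c where "c = foldr (\<lambda>x y. p (x, y))"
  have c: "c xs z = c ys z \<Longrightarrow> length xs = length ys \<Longrightarrow> xs = ys" for xs ys z
  proof (induction xs arbitrary: ys)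
    case (Cons x xs)
    then show ?case by (cases ys) (simp_all add: c_def inj_eq[OF p])
  qed auto
  \<comment> \<open>The fold \<open>c\<close> can be decoded only when the length is known, so the
    length is stored as well.\<close>
  have "inj (\<lambda>xs. p (n (length xs), c xs undefined))"
    by (rule injI) (auto simp: inj_eq[OF p] inj_eq[OF n] dest: c)
  then show ?thesis by blast
qed

section \<open>The additive natural numbers generate all commutative monoids\<close>

definition nat_add_monoid :: "nat monoid" where
  "nat_add_monoid = \<lparr>carrier = UNIV, monoid.mult = (+), one = 0\<rparr>"

lemma monoid_nat_add_monoid: "Group.monoid nat_add_monoid"
  by (rule monoidI) (auto simp: nat_add_monoid_def)

text \<open>A commutative monoid is a quotient of the free commutative monoid on its elements; the latter
  sits inside a power of the natural numbers, as the multiplicity vectors of words.\<close>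

lemma comm_monoid_in_variety:
  fixes K :: "('u::infinite) monoid set" and n :: "nat \<Rightarrow> 'u"
  assumes K: "is_variety K" and n: "inj n" and nat: "image_group n nat_add_monoid \<in> K"
    and N: "comm_monoid N"
  shows "N \<in> K"
proof -
  interpret comm_monoid N by fact
  define I where "I = carrier N"
  define P where "P = product_group I (\<lambda>_. image_group n nat_add_monoid)"
  define C where "C xs = (\<lambda>i\<in>I. n (count_list xs i))" for xs
  define S where "S = C ` lists I"
  \<comment> \<open>\<open>W\<close> picks a word with a given multiplicity vector. It serves twice:
    to define the quotient map and to code \<open>S\<close> into \<open>'u\<close>.\<close>
  define W where "W f = (SOME xs. xs \<in> lists I \<and> C xs = f)" for f
  have W: "W f \<in> lists I" "C (W f) = f" if "f \<in> S" for f
  proof -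
    have "\<exists>xs. xs \<in> lists I \<and> C xs = f" using that unfolding S_def by blast
    from someI_ex[OF this] show "W f \<in> lists I" "C (W f) = f" by (simp_all add: W_def)
  qed
  have P_mult: "C xs \<otimes>\<^bsub>P\<^esub> C ys = C (xs @ ys)" for xs ys
    using n by (auto simp: P_def C_def image_group_def nat_add_monoid_def)
  \<comment> \<open>The vector records only letters of \<open>I\<close>, but no others occur, so it
    determines a word up to order.\<close>
  have C_mset: "mset xs = mset ys" if "C xs = C ys" "xs \<in> lists I" "ys \<in> lists I" for xs ys
  proof (rule multiset_eqI)
    fix i
    show "count (mset xs) i = count (mset ys) i"
    proof (cases "i \<in> I")
      case True
      then show ?thesis
        using fun_cong[OF that(1), of i] n by (auto simp: C_def inj_eq count_mset)
    next
      case False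
      then have "i \<notin> set xs" "i \<notin> set ys" using that by auto
      then show ?thesis by (simp add: count_mset)
    qed
  qed
  define h where "h f = foldr (\<otimes>\<^bsub>N\<^esub>) (W f) \<one>\<^bsub>N\<^esub>" for f
  \<comment> \<open>The chosen word is a rearrangement of \<open>xs\<close>; commutativity makes the
    two products equal.\<close>
  have h_C: "h (C xs) = foldr (\<otimes>\<^bsub>N\<^esub>) xs \<one>\<^bsub>N\<^esub>" if "xs \<in> lists I" for xs
  proof -
    have "C xs \<in> S" using that by (simp add: S_def)
    note W[OF this]
    then have "mset (W (C xs)) = mset xs" "set (W (C xs)) \<subseteq> carrier N"
      using C_mset that by (blast, auto simp: I_def)
    then show ?thesis
      unfolding h_def by (rule multlist_perm_cong)
  qed
  have foldr_append: "foldr (\<otimes>\<^bsub>N\<^esub>) (xs @ ys) \<one>\<^bsub>N\<^esub>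
      = foldr (\<otimes>\<^bsub>N\<^esub>) xs \<one>\<^bsub>N\<^esub> \<otimes>\<^bsub>N\<^esub> foldr (\<otimes>\<^bsub>N\<^esub>) ys \<one>\<^bsub>N\<^esub>"
    if "xs \<in> lists I" "ys \<in> lists I" for xs ys
  proof -
    have "set ys \<subseteq> carrier N" using that by (auto simp: I_def)
    moreover have "set xs \<subseteq> carrier N" using that by (auto simp: I_def)
    ultimately show ?thesis by (induction xs) (simp_all add: m_assoc)
  qed
  have "h ` S = carrier N"
  \<comment> \<open>Each element is the value of the one-letter word formed from it.\<close>
  proof (intro equalityI subsetI)
    fix x assume "x \<in> carrier N"
    then have "[x] \<in> lists I" "h (C [x]) = x" using h_C[of "[x]"] by (auto simp: I_def)
    then show "x \<in> h ` S" unfolding S_def by (metis imageI)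
  qed (auto simp: S_def h_C I_def in_lists_conv_set intro!: multlist_closed)
  moreover from this have "h \<in> hom (P\<lparr>carrier := S\<rparr>) N"
    by (intro homI)
      (auto simp: S_def P_mult h_C foldr_append simp del: List.foldr_append del: in_listsD)
  ultimately have "h \<in> epi (P\<lparr>carrier := S\<rparr>) N" by (simp add: epi_def)
  moreover have "submonoid S P"
  proof
    show "S \<subseteq> carrier P"
      by (auto simp: S_def C_def P_def image_group_def nat_add_monoid_def)
    show "x \<otimes>\<^bsub>P\<^esub> y \<in> S" if "x \<in> S" "y \<in> S" for x y
      using that by (auto simp: S_def P_mult intro!: imageI)
    have "\<one>\<^bsub>P\<^esub> = C []"
      by (auto simp: C_def P_def image_group_def nat_add_monoid_def)
    then show "\<one>\<^bsub>P\<^esub> \<in> S" by (simp add: S_def)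
  qed
  moreover obtain e :: "'u list \<Rightarrow> 'u" where "inj e" using ex_inj_lists by blast
  \<comment> \<open>A vector is recovered from its chosen word by \<open>C\<close>, so coding the
    word codes the vector.\<close>
  then have "inj_on (\<lambda>f. e (W f)) S"
    using W(2) by (intro inj_onI) (metis injD)
  ultimately show ?thesis
    unfolding P_def using nat
    by (intro variety_epi_submonoid_product[OF K _ _ _ _ monoid_axioms]) auto
qed

section \<open>The identity xyxy = yxyx and the variety it defines\<close>

definition squares_commute :: "('a, 'b) monoid_scheme \<Rightarrow> bool" where
  "squares_commute M \<longleftrightarrow> (\<forall>x\<in>carrier M. \<forall>y\<in>carrier M.
     (x \<otimes>\<^bsub>M\<^esub> y) \<otimes>\<^bsub>M\<^esub> (x \<otimes>\<^bsub>M\<^esub> y) = (y \<otimes>\<^bsub>M\<^esub> x) \<otimes>\<^bsub>M\<^esub> (y \<otimes>\<^bsub>M\<^esub> x))"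

lemma squares_commute_epi:
  assumes "squares_commute M" "epi M N \<noteq> {}" "Group.monoid M"
  shows "squares_commute N"
proof -
  interpret Group.monoid M by fact
  obtain h where h: "h \<in> hom M N" "carrier N = h ` carrier M"
    using assms(2) by (auto simp: epi_def)
  show ?thesis
    using assms(1) unfolding squares_commute_def h(2)
    by (auto simp flip: hom_mult[OF h(1)])
qed

text \<open>The easy direction of Birkhoff's theorem: an identity passes to quotients and
  submonoids, and it holds in a product because it holds in each coordinate.\<close>

lemma is_variety_squares_commute:
  "is_variety {M :: ('u::infinite) monoid. Group.monoid M \<and> squares_commute M}"
  (is "is_variety ?K")
  unfolding is_variety_def
proof (intro conjI ballI allI impI)
  fix M N :: "'u monoid"
  assume "M \<in> ?K" "Group.monoid N \<and> epi M N \<noteq> {}"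
  then show "N \<in> ?K" using squares_commute_epi by blast
next
  fix M :: "'u monoid" and S
  assume "M \<in> ?K" "submonoid S M"
  then show "M\<lparr>carrier := S\<rparr> \<in> ?K"
    using submonoid.submonoid_is_monoid[of S M] submonoid.subset[of S M]
    by (auto simp: squares_commute_def subset_iff)
next
  fix I :: "'u set" and G :: "'u \<Rightarrow> 'u monoid" and S and N :: "'u monoid"
  let ?P = "product_group I G\<lparr>carrier := S\<rparr>"
  assume *: "(\<forall>i\<in>I. G i \<in> ?K) \<and> submonoid S (product_group I G) \<and> Group.monoid N \<and> ?P \<cong> N"
  then have "squares_commute ?P"
    using submonoid.subset[of S "product_group I G"]
    by (auto simp: squares_commute_def subset_iff PiE_iff fun_eq_iff)
  moreover have "Group.monoid ?P"
    using * submonoid.submonoid_is_monoid[of S "product_group I G"] monoid_product_group[of I G]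
    by blast
  moreover have "epi ?P N \<noteq> {}"
    using * by (auto simp: is_iso_def iso_def epi_def bij_betw_def)
  ultimately show "N \<in> ?K" using * squares_commute_epi by blast
qed auto

text \<open>Every variety containing the copies of \<open>M\<close> contains those of its quotients
  \<open>T\<close> and the natural numbers, hence the join. The variety defined by xyxy = yxyx
  contains the join but no copy of \<open>M\<close>, which gives strictness.\<close>

lemma join_comm_strict_subset:
  fixes M :: "'a monoid" and T :: "'b monoid"
  assumes M: "Group.monoid M" "countable (carrier M)" "\<not> squares_commute M"
    and T: "Group.monoid T" "squares_commute T"
    and epi: "epi M T \<noteq> {}" "epi M nat_add_monoid \<noteq> {}"
  shows "variety_join (variety_generated_by T) comm_monoids
    \<subset> (variety_generated_by M :: ('u::infinite) monoid set)"
proof (rule psubsetI)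
  obtain n :: "nat \<Rightarrow> 'u" where n: "inj n"
    using infinite_countable_subset[OF infinite_UNIV] by blast
  \<comment> \<open>Countability gives a copy of \<open>M\<close> on any infinite \<open>'u\<close>:
    number the carrier, then embed the numbers.\<close>
  define c where "c = n \<circ> to_nat_on (carrier M)"
  have c: "inj_on c (carrier M)"
    unfolding c_def using n inj_on_to_nat_on[OF M(2)]
    by (meson comp_inj_on inj_on_subset subset_UNIV)
  let ?M = "image_group c M"
  have M_copy: "Group.monoid ?M" "M \<cong> ?M" "inv_into (carrier M) c \<in> epi ?M M"
    using monoid_image_group[OF c M(1)] image_group_iso[OF c M(1)]
      inv_into_image_group_epi[OF c M(1)] by (auto simp: is_iso_def)
  have M_epi: "epi ?M M \<noteq> {}" using M_copy(3) by blast
  show "variety_join (variety_generated_by T) comm_monoids \<subseteq> (variety_generated_by M :: 'u monoid set)"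
    unfolding variety_generated_by_def[of M]
  proof (rule Inter_greatest, clarify)
    fix K :: "'u monoid set" and N :: "'u monoid"
    assume K: "is_variety K" "\<forall>N. Group.monoid N \<and> M \<cong> N \<longrightarrow> N \<in> K"
      and N: "N \<in> variety_join (variety_generated_by T) comm_monoids"
    have "?M \<in> K" using K(2) M_copy by blast
    then have quotient: "N \<in> K" if "epi M N \<noteq> {}" "Group.monoid N" for N
      using variety_epi[OF K(1)] that M_epi epi_compose by blast
    have "N \<in> K" if "T \<cong> N" "Group.monoid N" for N
    proof -
      have "epi T N \<noteq> {}" using that(1) by (auto simp: is_iso_def iso_def epi_def bij_betw_def)
      then show ?thesis using quotient[OF _ that(2)] epi(1) epi_compose by blast
    qed
    then have "variety_generated_by T \<subseteq> K"
      using K(1) by (auto simp: variety_generated_by_def)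
    moreover have "comm_monoids \<subseteq> K"
    proof -
      have n': "inj_on n (carrier nat_add_monoid)" using n by (rule inj_on_subset) simp
      have "image_group n nat_add_monoid \<in> K"
      proof (rule quotient)
        have "n \<in> epi nat_add_monoid (image_group n nat_add_monoid)"
          using image_group_iso[OF n' monoid_nat_add_monoid] by (simp add: iso_iff_mon_epi)
        then show "epi M (image_group n nat_add_monoid) \<noteq> {}" using epi(2) epi_compose by blast
      qed (rule monoid_image_group[OF n' monoid_nat_add_monoid])
      then show ?thesis
        using comm_monoid_in_variety[OF K(1) n] by (auto simp: comm_monoids_def)
    qed
    ultimately show "N \<in> K" using K(1) N by (auto simp: variety_join_def)
  qed
  \<comment> \<open>The variety that separates the two sides.\<close>
  let ?K = "{M :: 'u monoid. Group.monoid M \<and> squares_commute M}"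
  have "N \<in> ?K" if "Group.monoid N" "T \<cong> N" for N
  proof -
    have "epi T N \<noteq> {}" using that(2) by (auto simp: is_iso_def iso_def epi_def bij_betw_def)
    then show ?thesis using squares_commute_epi T that(1) by blast
  qed
  then have "variety_generated_by T \<subseteq> ?K"
    unfolding variety_generated_by_def by (intro Inter_lower CollectI conjI is_variety_squares_commute) blast
  moreover have "comm_monoids \<subseteq> ?K"
    by (auto simp: comm_monoids_def squares_commute_def comm_monoid.m_comm comm_monoid.axioms(1))
  ultimately have "variety_join (variety_generated_by T) comm_monoids \<subseteq> ?K"
    unfolding variety_join_def by (intro Inter_lower) (simp add: is_variety_squares_commute)
  \<comment> \<open>The identity would pass from the copy back to its image
    \<open>M\<close>.\<close>
  moreover have "?M \<notin> ?K"
    using M(3) squares_commute_epi[OF _ M_epi M_copy(1)] by blast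
  moreover have "?M \<in> variety_generated_by M"
    using M_copy(1,2) by (auto simp: variety_generated_by_def)
  ultimately show "variety_join (variety_generated_by T) comm_monoids
      \<noteq> (variety_generated_by M :: 'u monoid set)"
    by blast
qed

section \<open>The stylic and sylvester monoids\<close>

definition styl2_rel :: "(nat list \<times> nat list) set" where
  "styl2_rel = {([a, c, b], [c, a, b]) | a b c. {a, b, c} \<subseteq> {1, 2} \<and> a \<le> b \<and> b < c}
    \<union> {([b, a, c], [b, c, a]) | a b c. {a, b, c} \<subseteq> {1, 2} \<and> a < b \<and> b \<le> c}
    \<union> {([a, a], [a]) | a. a \<in> {1, 2}}"

abbreviation styl2_cong :: "(nat list \<times> nat list) set" where
  "styl2_cong \<equiv> presentation_cong {1, 2} styl2_rel"

lemma styl2_eq: "styl2 = presented_monoid {1, 2} styl2_rel"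
  by (simp add: styl2_def styl2_rel_def)

lemma styl2_rel_subset: "styl2_rel \<subseteq> lists {1, 2} \<times> lists {1, 2}"
  by (auto simp: styl2_rel_def)

lemma monoid_styl2: "Group.monoid styl2"
  unfolding styl2_eq by (rule monoid_presented_monoid[OF styl2_rel_subset])

text \<open>The class of \<open>[2, 1]\<close> turns out to be the zero of \<open>styl2\<close>, so
  congruences are proved by reducing both words to it.\<close>

lemma styl2_cong_zeroI:
  assumes "(u, [2, 1]) \<in> styl2_cong" "(v, [2, 1]) \<in> styl2_cong"
  shows "(u, v) \<in> styl2_cong"
  by (rule presentation_cong.trans[OF assms(1) presentation_cong.sym[OF assms(2)]])

text \<open>Idempotence removes a repeated letter from 211 and 221. The words 121 and 212 are first
  turned into these by the two cubic relations, with \<open>a = b = 1\<close>, \<open>c = 2\<close>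
  and with \<open>a = 1\<close>, \<open>b = c = 2\<close>.\<close>

lemma styl2_zero_mult:
  assumes "x \<in> {1, 2}"
  shows "([x, 2, 1], [2, 1]) \<in> styl2_cong" "([2, 1, x], [2, 1]) \<in> styl2_cong"
proof -
  have rel: "(p @ u @ q, p @ v @ q) \<in> styl2_cong"
    if "(u, v) \<in> styl2_rel" "p \<in> lists {1, 2}" "q \<in> lists {1, 2}" for p q u v
    using that by (rule presentation_cong.rel)
  have 211: "([2, 1, 1], [2, 1]) \<in> styl2_cong"
    using rel[of "[1, 1]" "[1]" "[2]" "[]"] by (simp add: styl2_rel_def)
  have 221: "([2, 2, 1], [2, 1]) \<in> styl2_cong"
    using rel[of "[2, 2]" "[2]" "[]" "[1]"] by (simp add: styl2_rel_def)
  have 121: "([1, 2, 1], [2, 1, 1]) \<in> styl2_cong"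
    using rel[of "[1, 2, 1]" "[2, 1, 1]" "[]" "[]"] by (simp add: styl2_rel_def)
  have 212: "([2, 1, 2], [2, 2, 1]) \<in> styl2_cong"
    using rel[of "[2, 1, 2]" "[2, 2, 1]" "[]" "[]"] by (simp add: styl2_rel_def)
  show "([x, 2, 1], [2, 1]) \<in> styl2_cong" "([2, 1, x], [2, 1]) \<in> styl2_cong"
    using assms 211 221 presentation_cong.trans[OF 121 211] presentation_cong.trans[OF 212 221]
    by auto
qed

lemma styl2_zero_append:
  assumes "w \<in> lists {1, 2}"
  shows "([2, 1] @ w, [2, 1]) \<in> styl2_cong" "(w @ [2, 1], [2, 1]) \<in> styl2_cong"
proof -
  have refl: "([2, 1], [2, 1]) \<in> styl2_cong" by (rule presentation_cong.refl) simp
  show "([2, 1] @ w, [2, 1]) \<in> styl2_cong"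
    using assms
  proof (induction w)
    case (Cons x w)
    then have "([2, 1, x] @ w, [2, 1] @ w) \<in> styl2_cong"
      using presentation_cong_context[OF styl2_zero_mult(2)[of x], of "[]" w] by simp
    then show ?case using Cons by (auto intro: presentation_cong.trans)
  qed (use refl in simp)
  show "(w @ [2, 1], [2, 1]) \<in> styl2_cong"
    using assms
  proof (induction w)
    case (Cons x w)
    then have "([x] @ w @ [2, 1], [x] @ [2, 1]) \<in> styl2_cong"
      using presentation_cong_context[of "w @ [2, 1]" "[2, 1]" "{1, 2}" styl2_rel "[x]" "[]"] by simp
    then show ?case
      using styl2_zero_mult(1)[of x] Cons.hyps by (auto intro: presentation_cong.trans)
  qed (use refl in simp)
qed

text \<open>If \<open>q\<close> starts with 1, a factor 21 appears and absorbs the rest; if it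
  starts with 2, the induction hypothesis leaves 221, which collapses.\<close>

lemma styl2_descent:
  assumes "q \<in> lists {1, 2}"
  shows "([2] @ q @ [1], [2, 1]) \<in> styl2_cong"
  using assms
proof (induction q)
  case Nil
  then show ?case by (auto intro: presentation_cong.refl)
next
  case (Cons x q)
  show ?case
  proof (cases "x = 1")
    case True
    then show ?thesis using styl2_zero_append(1)[of "q @ [1]"] Cons by simp
  next
    case False
    then have [simp]: "x = 2" using Cons by simp
    have "([2] @ ([2] @ q @ [1]) @ [], [2] @ [2, 1] @ []) \<in> styl2_cong"
      by (rule presentation_cong_context) (use Cons in auto)
    then show ?thesis using styl2_zero_mult(1)[of 2] by (auto intro: presentation_cong.trans)
  qed
qed

text \<open>The stretch from the 2 to the later 1 collapses to the zero, which then absorbs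
  \<open>p\<close> and \<open>r\<close>.\<close>

lemma styl2_descent_context:
  assumes "p @ [2] @ q @ [1] @ r \<in> lists {1, 2}"
  shows "(p @ [2] @ q @ [1] @ r, [2, 1]) \<in> styl2_cong"
proof -
  have "(p @ ([2] @ q @ [1]) @ r, p @ [2, 1] @ r) \<in> styl2_cong"
    by (rule presentation_cong_context) (use assms styl2_descent in auto)
  moreover have "([] @ (p @ [2, 1]) @ r, [] @ [2, 1] @ r) \<in> styl2_cong"
    by (rule presentation_cong_context) (use assms styl2_zero_append in auto)
  moreover have "([2, 1] @ r, [2, 1]) \<in> styl2_cong"
    using assms styl2_zero_append by auto
  ultimately show ?thesis by (auto intro: presentation_cong.trans)
qed

text \<open>A 2 in the first copy of \<open>w\<close> precedes a 1 in the second.\<close>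

lemma styl2_square_zero:
  assumes "w \<in> lists {1, 2}" "1 \<in> set w" "2 \<in> set w"
  shows "(w @ w, [2, 1]) \<in> styl2_cong"
proof -
  obtain p q where "w = p @ [2] @ q" using split_list[OF assms(3)] by auto
  moreover obtain r s where "w = r @ [1] @ s" using split_list[OF assms(2)] by auto
  ultimately have "w @ w = p @ [2] @ (q @ r) @ [1] @ s" by (metis append.assoc)
  then show ?thesis using styl2_descent_context[of p "q @ r" s] assms(1) by (metis append_in_lists_conv)
qed

lemma squares_commute_styl2: "squares_commute styl2"
proof -
  have "(u @ v @ u @ v, v @ u @ v @ u) \<in> styl2_cong"
    if uv: "u \<in> lists {1, 2}" "v \<in> lists {1, 2}" for u v
  \<comment> \<open>If both letters occur, both squares are zero. Otherwise both sides are powers of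
    a single letter with equal length, hence equal as words.\<close>
  proof (cases "1 \<in> set (u @ v) \<and> 2 \<in> set (u @ v)")
    case True
    have "((u @ v) @ (u @ v), [2, 1]) \<in> styl2_cong"
      by (rule styl2_square_zero) (use True uv in simp_all)
    moreover have "((v @ u) @ (v @ u), [2, 1]) \<in> styl2_cong"
      by (rule styl2_square_zero) (use True uv in \<open>simp_all add: disj_commute\<close>)
    ultimately have "((u @ v) @ (u @ v), (v @ u) @ (v @ u)) \<in> styl2_cong"
      by (rule styl2_cong_zeroI)
    then show ?thesis by simp
  next
    case False
    moreover have "set (u @ v) \<subseteq> {1, 2}" using uv by auto
    ultimately have "set (u @ v) \<subseteq> {1} \<or> set (u @ v) \<subseteq> {2}" by blast
    then obtain x where x: "set (u @ v) \<subseteq> {x}" by metis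
    have "u @ v @ u @ v = replicate (length (u @ v @ u @ v)) x"
      by (rule replicate_eqI) (use x in auto)
    moreover have "v @ u @ v @ u = replicate (length (u @ v @ u @ v)) x"
      by (rule replicate_eqI) (use x in auto)
    ultimately have eq: "u @ v @ u @ v = v @ u @ v @ u" by (rule HOL.trans[OF _ HOL.sym])
    show ?thesis unfolding eq by (rule presentation_cong.refl) (use uv in simp)
  qed
  then show ?thesis
    unfolding squares_commute_def styl2_eq carrier_presented_monoid
    by (auto simp: mult_presented_monoid[OF styl2_rel_subset]
        presentation_class_eq_iff[OF styl2_rel_subset] simp del: One_nat_def del: in_listsD)
qed

section \<open>Quotients of presented monoids, and failure of the identity\<close>

lemma epi_onto_styl2:
  fixes R :: "(nat list \<times> nat list) set"
  assumes R: "R \<subseteq> lists {1..} \<times> lists {1..}"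
    and erase: "\<And>u v. (u, v) \<in> R \<Longrightarrow>
      (filter (\<lambda>x. x \<le> 2) u, filter (\<lambda>x. x \<le> 2) v) \<in> styl2_cong"
  shows "epi (presented_monoid {1..} R) styl2 \<noteq> {}"
proof (rule presented_monoid_epi[OF R])
  let ?F = "\<lambda>w. styl2_cong `` {filter (\<lambda>x. x \<le> 2) w}"
  have erase_in: "filter (\<lambda>x. x \<le> 2) w \<in> lists {1, 2}" if "w \<in> lists {1..}" for w :: "nat list"
    using that by fastforce
  show "?F ` lists {1..} = carrier styl2"
  proof (intro equalityI subsetI)
    fix X assume "X \<in> carrier styl2"
    then obtain w where w: "w \<in> lists {1, 2}" "X = styl2_cong `` {w}"
      by (auto simp: styl2_eq carrier_presented_monoid)
    \<comment> \<open>Surjectivity: erasing letters above 2 fixes every word over 1 and 2.\<close>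
    then have "filter (\<lambda>x. x \<le> 2) w = w" "w \<in> lists {1..}"
      by (auto simp: filter_id_conv)
    then show "X \<in> ?F ` lists {1..}" using w(2) by (intro image_eqI[of _ _ w]) auto
  qed (use erase_in in \<open>auto simp: styl2_eq carrier_presented_monoid\<close>)
  show "?F (u @ v) = ?F u \<otimes>\<^bsub>styl2\<^esub> ?F v"
    if "u \<in> lists {1..}" "v \<in> lists {1..}" for u v
    unfolding styl2_eq using mult_presented_monoid[OF styl2_rel_subset erase_in erase_in] that by simp
  show "?F u = ?F v" if "(u, v) \<in> R" for u v
    using erase[OF that] equiv_class_eq[OF equiv_presentation_cong[OF styl2_rel_subset]] by blast
qed

lemma epi_onto_nat_add:
  assumes R: "R \<subseteq> lists A \<times> lists A" and "A \<noteq> {}"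
    and len: "\<And>u v. (u, v) \<in> R \<Longrightarrow> length u = length v"
  shows "epi (presented_monoid A R) nat_add_monoid \<noteq> {}"
proof (rule presented_monoid_epi[OF R])
  obtain a where "a \<in> A" using \<open>A \<noteq> {}\<close> by blast
  \<comment> \<open>Powers of a single letter realize every length.\<close>
  then have "n \<in> length ` lists A" for n
    by (intro image_eqI[of _ _ "replicate n a"]) auto
  then show "length ` lists A = carrier nat_add_monoid" by (auto simp: nat_add_monoid_def)
qed (auto simp: nat_add_monoid_def len)

text \<open>The classes of the generators 1 and 2 are the witnesses against xyxy = yxyx.\<close>

lemma not_squares_commute_presented_monoid:
  assumes R: "R \<subseteq> lists {1..} \<times> lists {1..}"
    and "([1, 2, 1, 2], [2, 1, 2, 1]) \<notin> presentation_cong {1..} R"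
  shows "\<not> squares_commute (presented_monoid {1::nat..} R)"
proof
  let ?c = "\<lambda>w. presentation_cong {1..} R `` {w}"
  assume sq: "squares_commute (presented_monoid {1..} R)"
  have gens: "?c [1] \<in> carrier (presented_monoid {1..} R)" "?c [2] \<in> carrier (presented_monoid {1..} R)"
    unfolding carrier_presented_monoid by (rule imageI; simp)+
  have "?c [1, 2, 1, 2] = ?c [2, 1, 2, 1]"
    using sq[unfolded squares_commute_def, rule_format, OF gens]
    by (simp add: mult_presented_monoid[OF R] del: One_nat_def)
  then show False using assms(2) presentation_class_eq_iff[OF R] by simp
qed

section \<open>The two sylvester congruences\<close>

definition sylv_rel :: "(nat list \<times> nat list) set" where
  "sylv_rel = {([c, a] @ v @ [b], [a, c] @ v @ [b]) | a b c v.
     {a, b, c} \<subseteq> {1..} \<and> v \<in> lists {1..} \<and> a \<le> b \<and> b < c}"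

definition sylv_sharp_rel :: "(nat list \<times> nat list) set" where
  "sylv_sharp_rel = {([b] @ v @ [a, c], [b] @ v @ [c, a]) | a b c v.
     {a, b, c} \<subseteq> {1..} \<and> v \<in> lists {1..} \<and> a < b \<and> b \<le> c}"

text \<open>If \<open>c = 2\<close> then \<open>a = b = 1\<close>, and after erasing both sides have
  a 2 before a 1, so both are zero. Otherwise \<open>c\<close> exceeds 2 and is erased, and the
  sides differed only in its position.\<close>

lemma sylv_rel_erase:
  assumes "(u, v) \<in> sylv_rel"
  shows "(filter (\<lambda>x. x \<le> 2) u, filter (\<lambda>x. x \<le> 2) v) \<in> styl2_cong"
proof -
  obtain a b c w where uv: "u = [c, a] @ w @ [b]" "v = [a, c] @ w @ [b]"
    and abc: "1 \<le> a" "a \<le> b" "b < c" and w: "w \<in> lists {1..}"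
    using assms by (auto simp: sylv_rel_def)
  let ?w = "filter (\<lambda>x. x \<le> 2) w"
  have w': "?w \<in> lists {1, 2}" using w by fastforce
  show ?thesis
  proof (cases "c = 2")
    case True
    then have [simp]: "a = 1" "b = 1" "c = 2" using abc by auto
    show ?thesis
      by (rule styl2_cong_zeroI)
        (use styl2_descent_context[of "[]" "[]" "?w @ [1]"] styl2_descent_context[of "[1]" "?w" "[]"] w'
          in \<open>auto simp: uv\<close>)
  next
    case False
    then have "filter (\<lambda>x. x \<le> 2) u = filter (\<lambda>x. x \<le> 2) v" using abc by (auto simp: uv)
    moreover have "filter (\<lambda>x. x \<le> 2) v \<in> lists {1, 2}" using w' abc by (auto simp: uv)
    ultimately show ?thesis by (auto intro: presentation_cong.refl)
  qed
qed

text \<open>Here \<open>c = 2\<close> forces \<open>a = 1\<close> and \<open>b = 2\<close>; the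
  leading 2 precedes the 1 on both sides, so both are zero. A larger \<open>c\<close> is erased,
  leaving equal words.\<close>

lemma sylv_sharp_rel_erase:
  assumes "(u, v) \<in> sylv_sharp_rel"
  shows "(filter (\<lambda>x. x \<le> 2) u, filter (\<lambda>x. x \<le> 2) v) \<in> styl2_cong"
proof -
  obtain a b c w where uv: "u = [b] @ w @ [a, c]" "v = [b] @ w @ [c, a]"
    and abc: "1 \<le> a" "a < b" "b \<le> c" and w: "w \<in> lists {1..}"
    using assms by (auto simp: sylv_sharp_rel_def)
  let ?w = "filter (\<lambda>x. x \<le> 2) w"
  have w': "?w \<in> lists {1, 2}" using w by fastforce
  show ?thesis
  proof (cases "c = 2")
    case True
    then have [simp]: "a = 1" "b = 2" "c = 2" using abc by auto
    show ?thesis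
      by (rule styl2_cong_zeroI)
        (use styl2_descent_context[of "[]" "?w" "[2]"] styl2_descent_context[of "[2] @ ?w" "[]" "[]"] w'
          in \<open>auto simp: uv\<close>)
  next
    case False
    then have "filter (\<lambda>x. x \<le> 2) u = filter (\<lambda>x. x \<le> 2) v" using abc by (auto simp: uv)
    moreover have "filter (\<lambda>x. x \<le> 2) v \<in> lists {1, 2}" using w' abc by (auto simp: uv)
    ultimately show ?thesis by (auto intro: presentation_cong.refl)
  qed
qed

text \<open>Both sides of each defining relation end in the same letter \<open>b\<close>, and a
  context changes the last letter of both alike.\<close>

lemma sylv_cong_last:
  assumes "(u, v) \<in> presentation_cong {1..} sylv_rel"
  shows "(u = [] \<longleftrightarrow> v = []) \<and> last u = last v"
  using assms
  by (induction rule: presentation_cong.induct) (auto simp: sylv_rel_def last_append)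

text \<open>Dually, both sides of each defining relation begin with \<open>b\<close>.\<close>

lemma sylv_sharp_cong_hd:
  assumes "(u, v) \<in> presentation_cong {1..} sylv_sharp_rel"
  shows "(u = [] \<longleftrightarrow> v = []) \<and> hd u = hd v"
  using assms
  by (induction rule: presentation_cong.induct) (auto simp: sylv_sharp_rel_def hd_append)

lemma countable_presented_monoid:
  fixes A :: "'a::countable set"
  shows "countable (carrier (presented_monoid A R))"
  by (simp add: carrier_presented_monoid)

theorem corollary4p6:
  shows "variety_join (variety_generated_by styl2) comm_monoids
           \<subset> (variety_generated_by sylv :: ('u::infinite) monoid set)
       \<and> variety_join (variety_generated_by styl2) comm_monoids
           \<subset> (variety_generated_by sylv_sharp :: 'u monoid set)"
proof
  \<comment> \<open>The common part of both claims: length-preserving relations that erase to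
    congruences of \<open>styl2\<close> and leave 1212 and 2121 incongruent.\<close>
  have strict: "variety_join (variety_generated_by styl2) comm_monoids
      \<subset> (variety_generated_by (presented_monoid {1..} R) :: 'u monoid set)"
    if "R \<subseteq> lists {1..} \<times> lists {1..}"
      and "\<And>u v. (u, v) \<in> R \<Longrightarrow> length u = length v"
      and "\<And>u v. (u, v) \<in> R \<Longrightarrow>
        (filter (\<lambda>x. x \<le> 2) u, filter (\<lambda>x. x \<le> 2) v) \<in> styl2_cong"
      and "([1, 2, 1, 2], [2, 1, 2, 1]) \<notin> presentation_cong {1..} R"
    for R :: "(nat list \<times> nat list) set"
    by (rule join_comm_strict_subset[OF monoid_presented_monoid[OF that(1)] countable_presented_monoid
          not_squares_commute_presented_monoid[OF that(1,4)] monoid_styl2 squares_commute_styl2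
          epi_onto_styl2[OF that(1,3)] epi_onto_nat_add[OF that(1) _ that(2)]]) auto
  show "variety_join (variety_generated_by styl2) comm_monoids
      \<subset> (variety_generated_by sylv :: 'u monoid set)"
  proof -
    have "sylv = presented_monoid {1..} sylv_rel"
      by (simp add: sylv_def sylv_rel_def)
    moreover have "sylv_rel \<subseteq> lists {1..} \<times> lists {1..}"
      by (auto simp: sylv_rel_def)
    moreover have "length u = length v" if "(u, v) \<in> sylv_rel" for u v
      using that by (auto simp: sylv_rel_def)
    \<comment> \<open>The last letters are 2 and 1.\<close>
    moreover have "([1, 2, 1, 2], [2, 1, 2, 1]) \<notin> presentation_cong {1..} sylv_rel"
      using sylv_cong_last[of "[1, 2, 1, 2]" "[2, 1, 2, 1]"] by auto
    ultimately show ?thesis using strict[of sylv_rel] sylv_rel_erase by simp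
  qed
  show "variety_join (variety_generated_by styl2) comm_monoids
      \<subset> (variety_generated_by sylv_sharp :: 'u monoid set)"
  proof -
    have "sylv_sharp = presented_monoid {1..} sylv_sharp_rel"
      by (simp add: sylv_sharp_def sylv_sharp_rel_def)
    moreover have "sylv_sharp_rel \<subseteq> lists {1..} \<times> lists {1..}"
      by (auto simp: sylv_sharp_rel_def)
    moreover have "length u = length v" if "(u, v) \<in> sylv_sharp_rel" for u v
      using that by (auto simp: sylv_sharp_rel_def)
    \<comment> \<open>The first letters are 1 and 2.\<close>
    moreover have "([1, 2, 1, 2], [2, 1, 2, 1]) \<notin> presentation_cong {1..} sylv_sharp_rel"
      using sylv_sharp_cong_hd[of "[1, 2, 1, 2]" "[2, 1, 2, 1]"] by auto
    ultimately show ?thesis using strict[of sylv_sharp_rel] sylv_sharp_rel_erase by simp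
  qed
qed

end
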